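(* Let $X$ be a set and let $f\in Zin(X)$. Then $f$ is a Lie element if and only if $p(f)=-f$.
   Context: All algebras are over a field $\mathbf{K}$ of characteristic $0$. A (right-)Zinbiel algebra is a (non-unital, non-associative) algebra with product $\circ$ satisfying $a\circ(b\circ c)=(a\circ b+b\circ a)\circ c$. $Zin(X)$ is the free Zinbiel algebra on the set $X$. For $a_1,\dots,a_n\in Zin(X)$, $a_1a_2\cdots a_n$ denotes the left-bracketed product $(\cdots(a_1\circ a_2)\circ\cdots)\circ a_n$. It is known (Loday) that the left-bracketed words $x_{i_1}x_{i_2}\cdots x_{i_n}$ ($n\ge 1$, all $x_{i_j}\in X$) form a linear basis of $Zin(X)$. The linear map $p:Zin(X)\to Zin(X)$ is defined on this basis by $p(x)=-x$ for $x\in X$; $p(yz)=zy$ for $y,z\in X$; and $p(x_{i_1}\cdots x_{i_m}yz)=x_{i_1}\cdots x_{i_m}zy$ for $m\ge1$ and $x_{i_1},\dots,x_{i_m},y,z\in X$. An element of $Zin(X)$ is a Lie element if it can be expressed through elements of $X$ using the commutator $[a,b]=a\circ b-b\circ a$ (and linear combinations), i.e. if it lies in the subalgebra $ST(X)$ of $Zin(X)^{(-)}=(Zin(X),[\,,])$ generated by $X$. *)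

theory Defs
  imports Complex_Main "HOL-Library.Poly_Mapping" "HOL-Library.Multiset"
begin

section \<open>Zinbiel algebras\<close>

locale zinbiel_algebra = vector_space scale
  for scale :: "'k::field \<Rightarrow> 'b::ab_group_add \<Rightarrow> 'b" +
  fixes A :: "'b set" and mul :: "'b \<Rightarrow> 'b \<Rightarrow> 'b"
  assumes carrier: "subspace A"
    and mul_closed: "a \<in> A \<Longrightarrow> b \<in> A \<Longrightarrow> mul a b \<in> A"
    and mul_add_left: "a \<in> A \<Longrightarrow> b \<in> A \<Longrightarrow> c \<in> A \<Longrightarrow> mul (a + b) c = mul a c + mul b c"
    and mul_add_right: "a \<in> A \<Longrightarrow> b \<in> A \<Longrightarrow> c \<in> A \<Longrightarrow> mul a (b + c) = mul a b + mul a c"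
    and mul_scale_left: "a \<in> A \<Longrightarrow> b \<in> A \<Longrightarrow> mul (scale r a) b = scale r (mul a b)"
    and mul_scale_right: "a \<in> A \<Longrightarrow> b \<in> A \<Longrightarrow> mul a (scale r b) = scale r (mul a b)"
    and zinbiel: "a \<in> A \<Longrightarrow> b \<in> A \<Longrightarrow> c \<in> A \<Longrightarrow>
      mul a (mul b c) = mul (mul a b + mul b a) c"

text \<open>The left-bracketed product of a nonempty list; the value on the empty list is irrelevant.\<close>

definition lbracket :: "('b \<Rightarrow> 'b \<Rightarrow> 'b) \<Rightarrow> 'b list \<Rightarrow> 'b" where
  "lbracket mul as = foldl mul (hd as) (tl as)"

definition lin_ext ::
    "('k::zero \<Rightarrow> 'b::comm_monoid_add \<Rightarrow> 'b) \<Rightarrow> ('w \<Rightarrow> 'b) \<Rightarrow> ('w \<Rightarrow>\<^sub>0 'k) \<Rightarrow> 'b" where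
  "lin_ext scale h f = (\<Sum>w\<in>Poly_Mapping.keys f. scale (Poly_Mapping.lookup f w) (h w))"

section \<open>The free Zinbiel algebra\<close>

text \<open>The free Zinbiel algebra on a set \<open>X\<close> is realised on the linear combinations of nonempty
  words over \<open>X\<close>, with Loday's half-shuffle product: if \<open>v\<close> ends in the letter \<open>x\<close> and \<open>v'\<close> is \<open>v\<close>
  without it, then \<open>u \<circ> v\<close> is the sum of all shuffles of \<open>u\<close> and \<open>v'\<close>, each followed by \<open>x\<close>.
  That this is a Zinbiel algebra, is free on \<open>X\<close>, and has the left-bracketed words in \<open>X\<close>
  as a basis is proved below (theorems \<open>zinbiel_algebra_Zin\<close>, \<open>Zin_free\<close>,
  \<open>lbracket_letters\<close>, \<open>Zin_basis\<close>).\<close>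

text \<open>Shuffles with multiplicity (the library function \<open>shuffles\<close> forgets multiplicities).\<close>

function shuffle :: "'x list \<Rightarrow> 'x list \<Rightarrow> 'x list multiset" where
  "shuffle u v =
    (if u = [] then {#v#} else if v = [] then {#u#}
     else image_mset (\<lambda>w. w @ [last u]) (shuffle (butlast u) v)
        + image_mset (\<lambda>w. w @ [last v]) (shuffle u (butlast v)))"
  by pat_completeness auto
termination by (relation "measure (\<lambda>(u, v). length u + length v)") auto

declare shuffle.simps [simp del]

definition zscale :: "'k::field \<Rightarrow> ('x list \<Rightarrow>\<^sub>0 'k) \<Rightarrow> ('x list \<Rightarrow>\<^sub>0 'k)" where
  "zscale c f = Poly_Mapping.map ((*) c) f"

definition word_mul :: "'x list \<Rightarrow> 'x list \<Rightarrow> ('x list \<Rightarrow>\<^sub>0 'k::field)" where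
  "word_mul u v = (\<Sum>w\<in>#shuffle u (butlast v). Poly_Mapping.single (w @ [last v]) 1)"

definition zmul :: "('x list \<Rightarrow>\<^sub>0 'k::field) \<Rightarrow> ('x list \<Rightarrow>\<^sub>0 'k) \<Rightarrow> ('x list \<Rightarrow>\<^sub>0 'k)" where
  "zmul f g = lin_ext zscale (\<lambda>u. lin_ext zscale (word_mul u) g) f"

definition Zin :: "'x set \<Rightarrow> ('x list \<Rightarrow>\<^sub>0 'k::field) set" where
  "Zin X = {f. Poly_Mapping.keys f \<subseteq> lists X - {[]}}"

definition letter :: "'x \<Rightarrow> ('x list \<Rightarrow>\<^sub>0 'k::field)" where
  "letter x = Poly_Mapping.single [x] 1"

section \<open>Lie elements and the map p\<close>

definition comm :: "('x list \<Rightarrow>\<^sub>0 'k::field) \<Rightarrow> ('x list \<Rightarrow>\<^sub>0 'k) \<Rightarrow> ('x list \<Rightarrow>\<^sub>0 'k)" where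
  "comm a b = zmul a b - zmul b a"

definition comm_subalgebra :: "('x list \<Rightarrow>\<^sub>0 'k::field) set \<Rightarrow> bool" where
  "comm_subalgebra S \<longleftrightarrow> module.subspace zscale S \<and> (\<forall>a\<in>S. \<forall>b\<in>S. comm a b \<in> S)"

definition ST :: "'x set \<Rightarrow> ('x list \<Rightarrow>\<^sub>0 'k::field) set" where
  "ST X = comm_subalgebra hull (letter ` X)"

text \<open>On words: \<open>p\<close> negates a single letter and interchanges the last two letters of a longer
  word. The empty word does not occur in elements of \<open>Zin X\<close>. See \<open>zin_p_props\<close> below for the
  description in terms of left-bracketed products.\<close>

definition word_p :: "'x list \<Rightarrow> ('x list \<Rightarrow>\<^sub>0 'k::field)" where
  "word_p w = (case rev w of
      [] \<Rightarrow> 0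
    | [x] \<Rightarrow> - Poly_Mapping.single [x] 1
    | z # y # r \<Rightarrow> Poly_Mapping.single (rev r @ [z, y]) 1)"

definition zin_p :: "('x list \<Rightarrow>\<^sub>0 'k::field) \<Rightarrow> ('x list \<Rightarrow>\<^sub>0 'k)" where
  "zin_p = lin_ext zscale word_p"

section \<open>Adequacy of the model\<close>

lemma lookup_zscale [simp]: "Poly_Mapping.lookup (zscale c f) w = c * Poly_Mapping.lookup f w"
  unfolding zscale_def by (simp add: Poly_Mapping.map.rep_eq when_def)

interpretation zs: vector_space zscale
  by unfold_locales (auto intro!: poly_mapping_eqI simp: lookup_add algebra_simps)

context vector_space
begin

lemma lin_ext_superset:
  assumes "finite K" "Poly_Mapping.keys f \<subseteq> K"
  shows "lin_ext scale h f = (\<Sum>w\<in>K. scale (Poly_Mapping.lookup f w) (h w))"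
  unfolding lin_ext_def
  by (rule sum.mono_neutral_left) (use assms in \<open>auto simp: in_keys_iff\<close>)

lemma lin_ext_add: "lin_ext scale h (f + g) = lin_ext scale h f + lin_ext scale h g"
proof -
  let ?K = "Poly_Mapping.keys f \<union> Poly_Mapping.keys g"
  have "Poly_Mapping.keys (f + g) \<subseteq> ?K" by (rule Poly_Mapping.keys_add)
  then show ?thesis
    by (subst (1 2 3) lin_ext_superset[of ?K])
      (auto simp: lookup_add scale_left_distrib sum.distrib)
qed

lemma lin_ext_zscale: "lin_ext scale h (zscale c f) = scale c (lin_ext scale h f)"
proof -
  have "Poly_Mapping.keys (zscale c f) \<subseteq> Poly_Mapping.keys f" by (auto simp: in_keys_iff)
  then show ?thesis
    by (subst (1 2) lin_ext_superset[of "Poly_Mapping.keys f"])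
      (auto simp: scale_sum_right)
qed

lemma lin_ext_linear: "Vector_Spaces.linear zscale scale (lin_ext scale h)"
  by unfold_locales (simp_all add: lin_ext_add lin_ext_zscale)

lemma lin_ext_single [simp]: "lin_ext scale h (Poly_Mapping.single w 1) = h w"
  by (simp add: lin_ext_def)

lemma lin_ext_0 [simp]: "lin_ext scale h 0 = 0"
  by (simp add: lin_ext_def)

lemma lin_ext_sum_mset:
  "lin_ext scale h (\<Sum>i\<in>#M. F i) = (\<Sum>i\<in>#M. lin_ext scale h (F i))"
  by (induction M) (simp_all add: lin_ext_add)

lemma lin_ext_fun_add:
  "lin_ext scale (\<lambda>w. h w + h' w) f = lin_ext scale h f + lin_ext scale h' f"
  by (simp add: lin_ext_def scale_right_distrib sum.distrib)

lemma lin_ext_fun_scale: "lin_ext scale (\<lambda>w. scale c (h w)) f = scale c (lin_ext scale h f)"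
  by (simp add: lin_ext_def scale_sum_right mult.commute)

end

lemma lin_ext_words: "lin_ext zscale (\<lambda>w. Poly_Mapping.single w 1) f = f"
proof -
  have "Poly_Mapping.lookup (lin_ext zscale (\<lambda>w. Poly_Mapping.single w 1) f) v
      = Poly_Mapping.lookup f v" for v
    by (simp add: lin_ext_def lookup_sum lookup_single when_def if_distrib in_keys_iff
        cong: if_cong)
  then show ?thesis by (rule poly_mapping_eqI)
qed

subsection \<open>The Zinbiel identity\<close>

lemma shuffle_Nil [simp]: "shuffle [] v = {#v#}" "shuffle u [] = {#u#}"
  by (subst shuffle.simps; simp)+

lemma shuffle_snoc:
  "shuffle (u @ [x]) (v @ [y]) =
    image_mset (\<lambda>w. w @ [x]) (shuffle u (v @ [y])) +
    image_mset (\<lambda>w. w @ [y]) (shuffle (u @ [x]) v)"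
  by (subst shuffle.simps) simp

lemma shuffle_assoc:
  fixes F :: "'x list \<Rightarrow> 'b::ab_group_add"
  shows "(\<Sum>w\<in>#shuffle b c. \<Sum>t\<in>#shuffle a w. F t) = (\<Sum>w\<in>#shuffle a b. \<Sum>t\<in>#shuffle w c. F t)"
proof (induction "length a + length b + length c" arbitrary: a b c F rule: less_induct)
  case less
  show ?case
  proof (cases "a = [] \<or> b = [] \<or> c = []")
    case True
    then show ?thesis by auto
  next
    case False
    then obtain a' x b' y c' z where abc: "a = a' @ [x]" "b = b' @ [y]" "c = c' @ [z]"
      by (metis rev_exhaust)
    have 1: "(\<Sum>w\<in>#shuffle b c. \<Sum>t\<in>#shuffle a' w. F (t @ [x]))
        = (\<Sum>w\<in>#shuffle a' b. \<Sum>t\<in>#shuffle w c. F (t @ [x]))"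
      by (rule less) (simp add: abc)
    have 2: "(\<Sum>w\<in>#shuffle b' c. \<Sum>t\<in>#shuffle a w. F (t @ [y]))
        = (\<Sum>w\<in>#shuffle a b'. \<Sum>t\<in>#shuffle w c. F (t @ [y]))"
      by (rule less) (simp add: abc)
    have 3: "(\<Sum>w\<in>#shuffle b c'. \<Sum>t\<in>#shuffle a w. F (t @ [z]))
        = (\<Sum>w\<in>#shuffle a b. \<Sum>t\<in>#shuffle w c'. F (t @ [z]))"
      by (rule less) (simp add: abc)
    show ?thesis
      using 1 2 3 unfolding abc
      by (simp add: shuffle_snoc image_mset.compositionality o_def sum_mset.distrib algebra_simps)
  qed
qed

lemma word_mul_snoc:
  "word_mul u (v @ [x]) = (\<Sum>w\<in>#shuffle u v. Poly_Mapping.single (w @ [x]) 1)"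
  by (simp add: word_mul_def)

lemma shuffle_commute: "shuffle u v = shuffle v u"
proof (induction "length u + length v" arbitrary: u v rule: less_induct)
  case less
  show ?case
  proof (cases "u = [] \<or> v = []")
    case True
    then show ?thesis by auto
  next
    case False
    then obtain u' x v' y where uv: "u = u' @ [x]" "v = v' @ [y]"
      by (metis rev_exhaust)
    have "shuffle u' v = shuffle v u'" "shuffle u v' = shuffle v' u"
      by (rule less; simp add: uv)+
    then show ?thesis unfolding uv by (simp add: shuffle_snoc add.commute)
  qed
qed

lemma word_mul_symm:
  assumes "u \<noteq> []" "v \<noteq> []"
  shows "word_mul u v + word_mul v u = (\<Sum>w\<in>#shuffle u v. Poly_Mapping.single w 1)"
proof -
  obtain u' x v' y where uv: "u = u' @ [x]" "v = v' @ [y]"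
    using assms by (metis rev_exhaust)
  show ?thesis
    unfolding uv by (simp add: word_mul_snoc shuffle_snoc image_mset.compositionality o_def
        shuffle_commute[of "v' @ [y]" u'] add.commute)
qed

lemma zmul_single [simp]: "zmul (Poly_Mapping.single u 1) (Poly_Mapping.single v 1) = word_mul u v"
  by (simp add: zmul_def)

lemma zmul_add_left: "zmul (f + f') g = zmul f g + zmul f' g"
  and zmul_add_right: "zmul f (g + g') = zmul f g + zmul f g'"
  and zmul_scale_left: "zmul (zscale c f) g = zscale c (zmul f g)"
  and zmul_scale_right: "zmul f (zscale c g) = zscale c (zmul f g)"
  by (simp_all add: zmul_def zs.lin_ext_add zs.lin_ext_zscale zs.lin_ext_fun_add
      zs.lin_ext_fun_scale)

lemma zmul_zero [simp]: "zmul 0 g = 0" "zmul f 0 = 0"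
  by (simp_all add: zmul_def lin_ext_def)

lemma zmul_sum_mset_left: "zmul (\<Sum>i\<in>#M. F i) g = (\<Sum>i\<in>#M. zmul (F i) g)"
  and zmul_sum_mset_right: "zmul f (\<Sum>i\<in>#M. F i) = (\<Sum>i\<in>#M. zmul f (F i))"
  by (induction M) (simp_all add: zmul_add_left zmul_add_right)

lemma Zin_eq_span:
  "(Zin X :: ('x list \<Rightarrow>\<^sub>0 'k::field) set) =
    zs.span ((\<lambda>w. Poly_Mapping.single w 1) ` (lists X - {[]}))"
    (is "_ = zs.span ?B")
proof
  show "Zin X \<subseteq> zs.span ?B"
  proof
    fix f :: "'x list \<Rightarrow>\<^sub>0 'k" assume f: "f \<in> Zin X"
    have "lin_ext zscale (\<lambda>w. Poly_Mapping.single w 1) f \<in> zs.span ?B"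
      unfolding lin_ext_def using f
      by (intro zs.span_sum zs.span_scale zs.span_base) (auto simp: Zin_def)
    then show "f \<in> zs.span ?B" by (simp add: lin_ext_words)
  qed
  have "zs.subspace (Zin X :: ('x list \<Rightarrow>\<^sub>0 'k) set)"
  proof (rule zs.subspaceI)
    show "0 \<in> Zin X" by (simp add: Zin_def)
    show "f + g \<in> Zin X" if "f \<in> Zin X" "g \<in> Zin X" for f g :: "'x list \<Rightarrow>\<^sub>0 'k"
      using that Poly_Mapping.keys_add[of f g] unfolding Zin_def by blast
    show "zscale c f \<in> Zin X" if "f \<in> Zin X" for c and f :: "'x list \<Rightarrow>\<^sub>0 'k"
      using that unfolding Zin_def by (auto simp: in_keys_iff)
  qed
  moreover have "?B \<subseteq> Zin X" by (auto simp: Zin_def)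
  ultimately show "zs.span ?B \<subseteq> Zin X" by (rule zs.span_minimal[rotated])
qed

lemma subspace_Zin: "zs.subspace (Zin X)"
  by (simp add: Zin_eq_span)

lemma Zin_induct [consumes 1, case_names zero word add scale]:
  assumes "f \<in> Zin X" "P 0" "\<And>w. w \<in> lists X \<Longrightarrow> w \<noteq> [] \<Longrightarrow> P (Poly_Mapping.single w 1)"
    and "\<And>f g. f \<in> Zin X \<Longrightarrow> g \<in> Zin X \<Longrightarrow> P f \<Longrightarrow> P g \<Longrightarrow> P (f + g)"
    and "\<And>c f. f \<in> Zin X \<Longrightarrow> P f \<Longrightarrow> P (zscale c f)"
  shows "P f"
proof -
  have "f \<in> zs.span ((\<lambda>w. Poly_Mapping.single w 1) ` (lists X - {[]}))"
    using assms(1) by (simp add: Zin_eq_span)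
  then have "f \<in> Zin X \<and> P f"
  proof (induction rule: zs.span_induct_alt)
    case base
    then show ?case using assms(2) zs.subspace_0[OF subspace_Zin] by auto
  next
    case (step c x y)
    then obtain w where w: "x = Poly_Mapping.single w 1" "w \<in> lists X" "w \<noteq> []" by auto
    then have x: "x \<in> Zin X" "P x" using assms(3) by (auto simp: Zin_def)
    then have "zscale c x \<in> Zin X" "P (zscale c x)"
      using assms(5) zs.subspace_scale[OF subspace_Zin] by auto
    then show ?case using step(2) assms(4) zs.subspace_add[OF subspace_Zin] by blast
  qed
  then show ?thesis by simp
qed

lemma set_shuffle: "w \<in># shuffle u v \<Longrightarrow> set w \<subseteq> set u \<union> set v"
proof (induction u v arbitrary: w rule: shuffle.induct)
  case (1 u v)
  show ?case
  proof (cases "u = [] \<or> v = []")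
    case True
    then show ?thesis using 1(3) by auto
  next
    case False
    then obtain t where "t \<in># shuffle (butlast u) v \<and> w = t @ [last u] \<or>
        t \<in># shuffle u (butlast v) \<and> w = t @ [last v]"
      using 1(3) by (subst (asm) shuffle.simps) auto
    then show ?thesis
      using 1(1)[of t] 1(2)[of t] False by (auto dest!: in_set_butlastD subsetD)
  qed
qed

lemma word_mul_in_Zin:
  assumes "u \<in> lists X" "v \<in> lists X" "v \<noteq> []"
  shows "word_mul u v \<in> Zin X"
proof -
  obtain v' y where v: "v = v' @ [y]" using assms(3) by (metis rev_exhaust)
  have sub: "(\<Sum>w\<in>#M. F w) \<in> Zin X" if "\<And>w. w \<in># M \<Longrightarrow> F w \<in> Zin X"
    for M and F :: "'a list \<Rightarrow> 'a list \<Rightarrow>\<^sub>0 'b"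
    using that
    by (induction M) (auto intro: zs.subspace_0[OF subspace_Zin] zs.subspace_add[OF subspace_Zin])
  have "Poly_Mapping.single (w @ [y]) (1::'b) \<in> Zin X" if "w \<in># shuffle u v'" for w
    using set_shuffle[OF that] assms unfolding v by (auto simp: Zin_def)
  then show ?thesis unfolding v word_mul_snoc by (rule sub)
qed

lemma zmul_in_Zin:
  assumes "f \<in> Zin X" "g \<in> Zin X"
  shows "zmul f g \<in> Zin X"
proof -
  have "word_mul u v \<in> (Zin X :: ('a list \<Rightarrow>\<^sub>0 'b) set)"
    if "u \<in> Poly_Mapping.keys f" "v \<in> Poly_Mapping.keys g" for u v
    by (rule word_mul_in_Zin)
      (use that assms in \<open>auto simp: Zin_def\<close>)
  then show ?thesis
    unfolding zmul_def lin_ext_def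
    by (intro zs.subspace_sum[OF subspace_Zin] zs.subspace_scale[OF subspace_Zin])
qed

lemma zmul_zinbiel_words:
  assumes "a \<noteq> []" "b \<noteq> []" "c \<noteq> []"
  shows "zmul (Poly_Mapping.single a 1) (word_mul b c) =
    zmul (word_mul a b + word_mul b a) (Poly_Mapping.single c 1)"
proof -
  obtain c' z where c: "c = c' @ [z]" using assms(3) by (metis rev_exhaust)
  show ?thesis
    unfolding word_mul_symm[OF assms(1,2)] zmul_sum_mset_left zmul_single
    unfolding c word_mul_snoc zmul_sum_mset_right zmul_single
    by (rule shuffle_assoc)
qed

lemma zmul_zinbiel:
  assumes "f \<in> Zin X" "g \<in> Zin X" "h \<in> Zin X"
  shows "zmul f (zmul g h) = zmul (zmul f g + zmul g f) h"
  using assms(1)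
proof (induction rule: Zin_induct)
  case (word a)
  show ?case using assms(2)
  proof (induction rule: Zin_induct)
    case (word b)
    show ?case using assms(3)
    proof (induction rule: Zin_induct)
      case (word c)
      then show ?case using \<open>a \<noteq> []\<close> \<open>b \<noteq> []\<close> by (simp add: zmul_zinbiel_words)
    qed (simp_all add: zmul_add_right zmul_scale_right)
  qed (simp_all add: zmul_add_left zmul_add_right zmul_scale_left zmul_scale_right ac_simps
      zs.scale_right_distrib)
qed (simp_all add: zmul_add_left zmul_add_right zmul_scale_left zmul_scale_right ac_simps
      zs.scale_right_distrib)

theorem zinbiel_algebra_Zin: "zinbiel_algebra zscale (Zin X) zmul"
  by unfold_locales
    (simp_all add: subspace_Zin zmul_in_Zin zmul_add_left zmul_add_right zmul_scale_left
      zmul_scale_right zmul_zinbiel[of _ X])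

subsection \<open>Left-bracketed words form a basis\<close>

lemma lbracket_snoc: "as \<noteq> [] \<Longrightarrow> lbracket mul (as @ [a]) = mul (lbracket mul as) a"
  by (simp add: lbracket_def)

lemma lbracket_single [simp]: "lbracket mul [a] = a"
  by (simp add: lbracket_def)

lemma lbracket_letters:
  assumes "w \<noteq> []"
  shows "lbracket zmul (map letter w) = Poly_Mapping.single w 1"
  using assms
proof (induction w rule: rev_nonempty_induct)
  case (single x)
  then show ?case by (simp add: lbracket_def letter_def)
next
  case (snoc x xs)
  then show ?case
    using word_mul_snoc[of xs "[]" x] by (simp add: lbracket_snoc letter_def)
qed

theorem Zin_basis:
  shows "inj_on (\<lambda>w. lbracket zmul (map letter w) :: 'x list \<Rightarrow>\<^sub>0 'k::field) (lists X - {[]})"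
    and "zs.independent ((\<lambda>w. lbracket zmul (map letter w) :: 'x list \<Rightarrow>\<^sub>0 'k) ` (lists X - {[]}))"
    and "zs.span ((\<lambda>w. lbracket zmul (map letter w) :: 'x list \<Rightarrow>\<^sub>0 'k) ` (lists X - {[]})) = Zin X"
proof -
  let ?s = "\<lambda>w. Poly_Mapping.single w 1 :: 'x list \<Rightarrow>\<^sub>0 'k"
  have eq: "(\<lambda>w. lbracket zmul (map letter w)) ` (lists X - {[]}) = ?s ` (lists X - {[]})"
    by (rule image_cong) (simp_all add: lbracket_letters)
  have inj: "inj ?s"
    by (rule injI) (metis lookup_single_eq lookup_single_not_eq zero_neq_one)
  show "inj_on (\<lambda>w. lbracket zmul (map letter w) :: 'x list \<Rightarrow>\<^sub>0 'k) (lists X - {[]})"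
    by (rule inj_onI) (use inj in \<open>auto simp: lbracket_letters dest: injD\<close>)
  show "zs.span ((\<lambda>w. lbracket zmul (map letter w) :: 'x list \<Rightarrow>\<^sub>0 'k) ` (lists X - {[]})) = Zin X"
    unfolding eq Zin_eq_span ..
  show "zs.independent ((\<lambda>w. lbracket zmul (map letter w) :: 'x list \<Rightarrow>\<^sub>0 'k) ` (lists X - {[]}))"
    unfolding eq
  proof (rule zs.independent_mono[OF _ image_mono])
    show "zs.independent (range ?s)"
      unfolding zs.dependent_def
    proof clarsimp
      fix w assume "?s w \<in> zs.span (range ?s - {?s w})"
      also have "range ?s - {?s w} \<subseteq> {f. Poly_Mapping.lookup f w = 0}"
        by (auto simp: lookup_single when_def)
      then have "zs.span (range ?s - {?s w}) \<subseteq> {f. Poly_Mapping.lookup f w = 0}"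
        by (rule zs.span_minimal) (auto simp: zs.subspace_def lookup_add)
      finally show False by simp
    qed
  qed simp
qed

subsection \<open>Universal property\<close>

context zinbiel_algebra
begin

lemma mul_zero_left: "b \<in> A \<Longrightarrow> mul 0 b = 0"
  and mul_zero_right: "b \<in> A \<Longrightarrow> mul b 0 = 0"
  using mul_scale_left[of b b 0] mul_scale_right[of b b 0] by auto

lemma sum_mset_closed:
  assumes "\<And>i. i \<in># M \<Longrightarrow> F i \<in> A"
  shows "(\<Sum>i\<in>#M. F i) \<in> A"
  using assms by (induction M) (auto intro: subspace_0[OF carrier] subspace_add[OF carrier])

lemma mul_sum_mset_left:
  assumes "\<And>i. i \<in># M \<Longrightarrow> F i \<in> A" "b \<in> A"
  shows "mul (\<Sum>i\<in>#M. F i) b = (\<Sum>i\<in>#M. mul (F i) b)"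
  using assms
  by (induction M) (auto simp: mul_zero_left mul_add_left sum_mset_closed)

lemma lbracket_closed:
  assumes "as \<in> lists A" "as \<noteq> []"
  shows "lbracket mul as \<in> A"
  using assms(2,1)
  by (induction as rule: rev_nonempty_induct)
    (auto simp: lbracket_snoc mul_closed)

lemma lbracket_mul:
  assumes "g ` X \<subseteq> A" "u \<in> lists X" "v \<in> lists X" "x \<in> X" "u \<noteq> []"
  shows "mul (lbracket mul (map g u)) (lbracket mul (map g (v @ [x]))) =
    (\<Sum>w\<in>#shuffle u v. lbracket mul (map g (w @ [x])))"
  using assms(2-)
proof (induction "length u + length v" arbitrary: u v x rule: less_induct)
  case less
  have lb: "lbracket mul (map g w) \<in> A" if "set w \<subseteq> X" "w \<noteq> []" for w
    using that assms(1) by (intro lbracket_closed) (auto simp: image_subset_iff subset_iff)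
  show ?case
  proof (cases v rule: rev_cases)
    case Nil
    then show ?thesis using less.prems by (simp add: lbracket_snoc)
  next
    case (snoc v' y)
    obtain u' z where u: "u = u' @ [z]" using less.prems by (metis rev_exhaust)
    have X: "set u' \<subseteq> X" "set v' \<subseteq> X" "z \<in> X" "y \<in> X" using less.prems snoc u by auto
    let ?L = "\<lambda>w. lbracket mul (map g w)"
    have 1: "mul (?L u) (?L v) = (\<Sum>w\<in>#shuffle u v'. ?L (w @ [y]))"
      unfolding snoc using less.prems X by (intro less.hyps) (auto simp: snoc)
    have ne: "w \<noteq> []" if "w \<in># shuffle s t" "s \<noteq> [] \<or> t \<noteq> []" for w s t :: "'c list"
      using that by (subst (asm) shuffle.simps) (auto split: if_splits)
    have 2: "mul (?L v) (?L u) = (\<Sum>w\<in>#shuffle u' v. ?L (w @ [z]))"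
    proof -
      have "mul (?L v) (?L u) = (\<Sum>w\<in>#shuffle v u'. ?L (w @ [z]))"
        unfolding u using less.prems X by (intro less.hyps) (auto simp: snoc u)
      then show ?thesis by (simp add: shuffle_commute)
    qed
    have "mul (?L u) (?L (v @ [x])) = mul (?L u) (mul (?L v) (g x))"
      using snoc lbracket_snoc[of "map g v" mul "g x"] by simp
    also have "\<dots> = mul (mul (?L u) (?L v) + mul (?L v) (?L u)) (g x)"
      using less.prems assms(1) snoc by (intro zinbiel lb) auto
    also have "\<dots> = mul (\<Sum>w\<in>#shuffle u v. ?L w) (g x)"
      unfolding 1 2 by (simp add: u snoc shuffle_snoc image_mset.compositionality o_def add.commute)
    also have "\<dots> = (\<Sum>w\<in>#shuffle u v. mul (?L w) (g x))"
    proof (rule mul_sum_mset_left)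
      fix w assume w: "w \<in># shuffle u v"
      show "?L w \<in> A" using set_shuffle[OF w] ne[OF w] less.prems by (intro lb) auto
    qed (use less.prems assms(1) in auto)
    also have "\<dots> = (\<Sum>w\<in>#shuffle u v. ?L (w @ [x]))"
      using ne[of _ u v] less.prems
      by (intro arg_cong[of _ _ sum_mset] image_mset_cong) (simp add: lbracket_snoc)
    finally show ?thesis .
  qed
qed

definition zin_hom :: "'x set \<Rightarrow> (('x list \<Rightarrow>\<^sub>0 'k) \<Rightarrow> 'b) \<Rightarrow> bool" where
  "zin_hom X \<phi> \<longleftrightarrow>
    (\<forall>a\<in>Zin X. \<phi> a \<in> A) \<and>
    (\<forall>a\<in>Zin X. \<forall>b\<in>Zin X. \<phi> (a + b) = \<phi> a + \<phi> b) \<and>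
    (\<forall>c. \<forall>a\<in>Zin X. \<phi> (zscale c a) = scale c (\<phi> a)) \<and>
    (\<forall>a\<in>Zin X. \<forall>b\<in>Zin X. \<phi> (zmul a b) = mul (\<phi> a) (\<phi> b))"

theorem Zin_free:
  fixes X :: "'d set" and \<phi> \<psi> :: "('d list \<Rightarrow>\<^sub>0 'k) \<Rightarrow> 'b"
  assumes "g ` X \<subseteq> A"
  shows "\<exists>\<phi>. zin_hom X \<phi> \<and> (\<forall>x\<in>X. \<phi> (letter x) = g x)"
    and "zin_hom X \<phi> \<Longrightarrow> \<forall>x\<in>X. \<phi> (letter x) = g x \<Longrightarrow>
         zin_hom X \<psi> \<Longrightarrow> \<forall>x\<in>X. \<psi> (letter x) = g x \<Longrightarrow> f \<in> Zin X \<Longrightarrow> \<phi> f = \<psi> f"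
proof -
  let ?h = "\<lambda>w. lbracket mul (map g w)"
  let ?P = "lin_ext scale ?h"
  have hA: "?h w \<in> A" if "w \<in> lists X" "w \<noteq> []" for w
    using that assms by (intro lbracket_closed) (auto simp: image_subset_iff subset_iff)
  have cl: "?P f \<in> A" if "f \<in> Zin X" for f
    using that
    by (induction rule: Zin_induct)
      (auto simp: lin_ext_add lin_ext_zscale hA intro: subspace_0[OF carrier]
        subspace_add[OF carrier] subspace_scale[OF carrier])
  have mul: "?P (zmul a b) = mul (?P a) (?P b)" if a: "a \<in> Zin X" and b: "b \<in> Zin X" for a b
    using a
  proof (induction rule: Zin_induct)
    case (word u)
    show ?case using b
    proof (induction rule: Zin_induct)
      case (word v)
      then obtain v' x where v: "v = v' @ [x]" by (metis rev_exhaust)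
      have "?P (word_mul u v) = (\<Sum>w\<in>#shuffle u v'. ?h (w @ [x]))"
        unfolding v word_mul_snoc lin_ext_sum_mset lin_ext_single ..
      also have "\<dots> = mul (?h u) (?h v)"
        unfolding v using word \<open>u \<in> lists X\<close> \<open>u \<noteq> []\<close> assms v
        by (intro lbracket_mul[symmetric, of g X]) auto
      finally show ?case by simp
    qed (use hA[OF word] in \<open>simp_all add: mul_zero_right zmul_add_right zmul_scale_right
        lin_ext_add lin_ext_zscale mul_add_right mul_scale_right cl\<close>)
  qed (use cl[OF b] in \<open>simp_all add: mul_zero_left zmul_add_left zmul_scale_left
        lin_ext_add lin_ext_zscale mul_add_left mul_scale_left cl\<close>)
  have "zin_hom X ?P \<and> (\<forall>x\<in>X. ?P (letter x) = g x)"
    by (auto simp: zin_hom_def cl mul lin_ext_add lin_ext_zscale letter_def)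
  then show "\<exists>\<phi>. zin_hom X \<phi> \<and> (\<forall>x\<in>X. \<phi> (letter x) = g x)" by blast
next
  assume \<phi>: "zin_hom X \<phi>" "\<forall>x\<in>X. \<phi> (letter x) = g x"
    and \<psi>: "zin_hom X \<psi>" "\<forall>x\<in>X. \<psi> (letter x) = g x"
    and "f \<in> Zin X"
  have words: "\<theta> (lbracket zmul (map letter w)) = lbracket mul (map g w)"
    if \<theta>: "zin_hom X \<theta>" "\<forall>x\<in>X. \<theta> (letter x) = g x" and "w \<noteq> []" "w \<in> lists X" for \<theta> w
    using that(3,4)
  proof (induction w rule: rev_nonempty_induct)
    case (single x)
    then show ?case using \<theta> by (simp add: lbracket_def)
  next
    case (snoc x xs)
    have "lbracket zmul (map letter xs) \<in> (Zin X :: ('d list \<Rightarrow>\<^sub>0 'k) set)"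
      "letter x \<in> (Zin X :: ('d list \<Rightarrow>\<^sub>0 'k) set)"
      using snoc by (auto simp: lbracket_letters Zin_def letter_def)
    then show ?case using snoc \<theta> by (simp add: lbracket_snoc zin_hom_def)
  qed
  show "\<phi> f = \<psi> f" using \<open>f \<in> Zin X\<close>
  proof (induction rule: Zin_induct)
    case zero
    have z: "\<theta> 0 = 0" if "zin_hom X \<theta>" for \<theta>
      using that zs.subspace_0[OF subspace_Zin, of X] unfolding zin_hom_def
      by (metis add_cancel_left_left)
    show ?case using z[OF \<phi>(1)] z[OF \<psi>(1)] by simp
  next
    case (word w)
    then show ?case using words[OF \<phi>, of w] words[OF \<psi>, of w] by (simp add: lbracket_letters)
  qed (use \<phi>(1) \<psi>(1) in \<open>simp_all add: zin_hom_def\<close>)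
qed

end

subsection \<open>The map p on left-bracketed words\<close>

theorem zin_p_props:
  shows "Vector_Spaces.linear zscale zscale zin_p"
    and "zin_p (letter x) = - letter x"
    and "zin_p (lbracket zmul (map letter (w @ [y, z]))) = lbracket zmul (map letter (w @ [z, y]))"
proof -
  show "Vector_Spaces.linear zscale zscale zin_p"
    unfolding zin_p_def by (rule zs.lin_ext_linear)
  show "zin_p (letter x) = - letter x"
    by (simp add: zin_p_def letter_def word_p_def)
  have "zin_p (Poly_Mapping.single (w @ [y, z]) 1) = Poly_Mapping.single (w @ [z, y]) 1"
    by (simp add: zin_p_def word_p_def)
  then show "zin_p (lbracket zmul (map letter (w @ [y, z]))) = lbracket zmul (map letter (w @ [z, y]))"
    by (simp only: lbracket_letters[of "w @ [_, _]"] append_is_Nil_conv list.distinct simp_thms)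
qed

end

theory Submission
  imports Defs
begin

text \<open>The elements with \<open>p f = - f\<close> are closed under commutators, because up to terms that are
  already skew in the last two letters a product inherits its last two letters from one factor.
  They are spanned by the letters and the elements \<open>u s t - u t s\<close> with \<open>u\<close> a word, so conversely
  these must be produced from commutators.

  In any Zinbiel algebra let \<open>S\<close> be a subspace closed under commutators. Induct on the length \<open>n\<close>
  of a left-bracketed word \<open>u\<close> in elements of \<open>S\<close> to show \<open>u s t - u t s \<in> S\<close>. By induction,
  modulo \<open>S\<close> this element does not change when two neighbours in \<open>u\<close> are interchanged. The
  commutators \<open>[v a b - v b a, t]\<close> with \<open>v\<close> of length \<open>n - 1\<close> then give \<open>x + y - n z \<in> S\<close> and its
  cyclic shifts for \<open>x = v a b t - v a t b\<close>, \<open>y = v b t a - v b a t\<close>, \<open>z = v t a b - v t b a\<close>, hence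
  \<open>x \<in> S\<close> unless \<open>n = 2\<close>. For \<open>n = 2\<close>, the case of length 1 with \<open>v\<close>, \<open>a\<close> and \<open>[b, t]\<close> yields the
  missing relation \<open>x - 2 y - 2 z \<in> S\<close>.\<close>

lemma (in vector_space) subspace_scale_cancel:
  assumes "subspace T" "scale c x \<in> T" "c \<noteq> 0"
  shows "x \<in> T"
  using subspace_scale[OF assms(1,2), of "inverse c"] assms(3) by simp

section \<open>Skew elements and commutators in a Zinbiel algebra\<close>

context zinbiel_algebra
begin

lemma mul_diff_left:
  assumes "a \<in> A" "b \<in> A" "c \<in> A"
  shows "mul (a - b) c = mul a c - mul b c"
proof -
  have "mul (a - b + b) c = mul (a - b) c + mul b c"
    using assms subspace_diff[OF carrier] by (intro mul_add_left) auto
  then show ?thesis by simp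
qed

lemma mul_diff_right:
  assumes "a \<in> A" "b \<in> A" "c \<in> A"
  shows "mul a (b - c) = mul a b - mul a c"
proof -
  have "mul a (b - c + c) = mul a (b - c) + mul a c"
    using assms subspace_diff[OF carrier] by (intro mul_add_right) auto
  then show ?thesis by simp
qed

lemma foldl_mul_diff:
  "a \<in> A \<Longrightarrow> b \<in> A \<Longrightarrow> set ys \<subseteq> A \<Longrightarrow> foldl mul (a - b) ys = foldl mul a ys - foldl mul b ys"
  by (induction ys arbitrary: a b) (auto simp: mul_closed mul_diff_left)

lemma foldl_mul_scale:
  "a \<in> A \<Longrightarrow> set ys \<subseteq> A \<Longrightarrow> foldl mul (scale c a) ys = scale c (foldl mul a ys)"
  by (induction ys arbitrary: a) (auto simp: mul_closed mul_scale_left)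

text \<open>On words of the free algebra this is the full shuffle product, by
  \<open>word_mul_symm\<close>.\<close>

definition symm :: "'b \<Rightarrow> 'b \<Rightarrow> 'b" where
  "symm a b = mul a b + mul b a"

definition skew :: "'b \<Rightarrow> 'b \<Rightarrow> 'b \<Rightarrow> 'b" where
  "skew u s t = mul (mul u s) t - mul (mul u t) s"

lemma symm_closed: "a \<in> A \<Longrightarrow> b \<in> A \<Longrightarrow> symm a b \<in> A"
  unfolding symm_def by (intro subspace_add[OF carrier] mul_closed)

lemma skew_closed: "u \<in> A \<Longrightarrow> s \<in> A \<Longrightarrow> t \<in> A \<Longrightarrow> skew u s t \<in> A"
  unfolding skew_def by (intro subspace_diff[OF carrier] mul_closed)

lemma skew_flip: "skew u t s = - skew u s t"
  by (simp add: skew_def)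

lemma zinbiel_symm: "a \<in> A \<Longrightarrow> b \<in> A \<Longrightarrow> c \<in> A \<Longrightarrow> mul a (mul b c) = mul (symm a b) c"
  by (simp add: symm_def zinbiel)

lemma symm_mul:
  "t \<in> A \<Longrightarrow> P \<in> A \<Longrightarrow> x \<in> A \<Longrightarrow> symm t (mul P x) = mul (symm t P) x + mul (mul P x) t"
  by (simp add: symm_def[of t "mul P x"] zinbiel_symm)

lemma skew_add:
  "u \<in> A \<Longrightarrow> u' \<in> A \<Longrightarrow> s \<in> A \<Longrightarrow> t \<in> A \<Longrightarrow> skew (u + u') s t = skew u s t + skew u' s t"
  by (simp add: skew_def mul_add_left mul_closed)

lemma skew_diff:
  "u \<in> A \<Longrightarrow> u' \<in> A \<Longrightarrow> s \<in> A \<Longrightarrow> t \<in> A \<Longrightarrow> skew (u - u') s t = skew u s t - skew u' s t"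
  by (simp add: skew_def mul_diff_left mul_closed)

lemma skew_scale:
  "u \<in> A \<Longrightarrow> s \<in> A \<Longrightarrow> t \<in> A \<Longrightarrow> skew (scale c u) s t = scale c (skew u s t)"
  by (simp add: skew_def mul_scale_left mul_closed scale_right_diff_distrib)

text \<open>The Zinbiel identity splits \<open>t\<close> times the word \<open>P x y\<close> into
  \<open>symm t P\<close> followed by \<open>x y\<close>, and \<open>P x t y\<close>. The latter
  words pair up with those ending in \<open>t\<close> to form the first two skew terms.\<close>

lemma commutator_skew:
  assumes "P \<in> A" "a \<in> A" "b \<in> A" "t \<in> A"
  shows "mul (skew P a b) t - mul t (skew P a b) =
    skew (mul P a) b t + skew (mul P b) t a - skew (symm t P) a b"
proof -
  have *: "mul t (mul (mul P x) y) = mul (mul (symm t P) x) y + mul (mul (mul P x) t) y"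
    if "x \<in> A" "y \<in> A" for x y
    using that assms by (simp add: zinbiel_symm symm_mul mul_closed mul_add_left symm_closed)
  show ?thesis
    using assms
    by (simp add: skew_def mul_diff_left mul_diff_right mul_closed *)
qed

lemma commutator_commutator:
  assumes "a \<in> A" "b \<in> A" "t \<in> A"
  shows "mul (mul a b - mul b a) t - mul t (mul a b - mul b a) =
    skew a b t + skew b t a - skew t a b"
  using assms
  by (simp add: skew_def mul_diff_left mul_diff_right mul_closed zinbiel mul_add_left)

text \<open>This supplies the additional relation for words of length 2, where the relations from
  \<open>commutator_skew\<close> do not suffice.\<close>

lemma skew_commutator:
  assumes "f \<in> A" "b \<in> A" "s \<in> A" "t \<in> A"
  shows "skew f b (mul s t - mul t s) =
    skew (mul f b) s t + skew (symm s f) b t - skew (symm t f) b s"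
proof -
  have *: "skew f b (mul x y) = mul (mul (mul f b) x) y + skew (symm x f) b y"
    if "x \<in> A" "y \<in> A" for x y
  proof -
    have "mul (mul f b) (mul x y) = mul (mul (mul f b) x) y + mul (mul (symm x f) b) y"
      using assms that zinbiel_symm[of "mul f b" x y] symm_mul[of x f b]
      by (simp add: mul_closed symm_closed mul_add_left symm_def[of _ "mul f b"]
          symm_def[of "mul f b"] add.commute)
    moreover have "mul (mul f (mul x y)) b = mul (mul (symm x f) y) b"
      using assms that zinbiel_symm[of f x y] by (simp add: symm_def add.commute)
    ultimately show ?thesis by (simp add: skew_def)
  qed
  have "skew f b (mul s t - mul t s) = skew f b (mul s t) - skew f b (mul t s)"
    using assms by (simp add: skew_def mul_diff_left mul_diff_right mul_closed)
  also have "\<dots> = (mul (mul (mul f b) s) t + skew (symm s f) b t)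
      - (mul (mul (mul f b) t) s + skew (symm t f) b s)"
    using assms by (simp only: *)
  also have "\<dots> = skew (mul f b) s t + skew (symm s f) b t - skew (symm t f) b s"
    by (simp add: skew_def[of "mul f b"])
  finally show ?thesis .
qed

end

section \<open>Words in a subspace closed under commutators\<close>

locale commutator_closed = zinbiel_algebra scale A mul
  for scale :: "'k::field_char_0 \<Rightarrow> 'b::ab_group_add \<Rightarrow> 'b" and A mul +
  fixes S :: "'b set"
  assumes subspace_S: "subspace S" and S_subset: "S \<subseteq> A"
    and commutator_in_S: "a \<in> S \<Longrightarrow> b \<in> S \<Longrightarrow> mul a b - mul b a \<in> S"
begin

text \<open>The target of the induction. A congruence of prefixes modulo \<open>R\<close> becomes a
  congruence of their skew elements modulo \<open>S\<close>.\<close>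

definition R :: "'b set" where
  "R = {u \<in> A. \<forall>s\<in>S. \<forall>t\<in>S. skew u s t \<in> S}"

lemma S_in_A [simp, intro]: "a \<in> S \<Longrightarrow> a \<in> A"
  using S_subset by blast

lemma subspace_R: "subspace R"
proof (rule subspaceI)
  show "0 \<in> R"
    using subspace_0[OF subspace_S] subspace_0[OF carrier]
    by (auto simp: R_def skew_def mul_zero_left)
qed (auto simp: R_def skew_add skew_scale intro: subspace_add[OF carrier] subspace_add[OF subspace_S]
    subspace_scale[OF carrier] subspace_scale[OF subspace_S])

lemma skew_in_S: "u \<in> R \<Longrightarrow> s \<in> S \<Longrightarrow> t \<in> S \<Longrightarrow> skew u s t \<in> S"
  by (simp add: R_def)

lemma skew_cong:
  assumes "u - scale c u' \<in> R" "u \<in> A" "u' \<in> A" "s \<in> S" "t \<in> S"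
  shows "skew u s t - scale c (skew u' s t) \<in> S"
  using skew_in_S[OF assms(1,4,5)] assms
  by (simp add: skew_diff skew_scale subspace_scale[OF carrier])

text \<open>The three relations add up to \<open>2 - c\<close> times \<open>x + y + z\<close>;
  subtracting the second one from \<open>x + y + z\<close> leaves \<open>1 + c\<close> times
  \<open>x\<close>.\<close>

lemma cyclic_cancel:
  assumes "x + y - scale c z \<in> S" "y + z - scale c x \<in> S" "z + x - scale c y \<in> S"
    and "c \<noteq> 2" "c \<noteq> -1"
  shows "x \<in> S"
proof -
  have "scale (2 - c) (x + y + z) =
      (x + y - scale c z) + (y + z - scale c x) + (z + x - scale c y)"
    by (simp add: scale_left_diff_distrib scale_right_distrib
        scale_left_distrib[of 1 1, simplified] algebra_simps)
  also have "\<dots> \<in> S"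
    by (intro subspace_add[OF subspace_S] assms)
  finally have "x + y + z \<in> S"
    using assms(4) by (auto intro: subspace_scale_cancel[OF subspace_S])
  from subspace_diff[OF subspace_S this assms(2)]
  have "scale (1 + c) x \<in> S"
    by (simp add: scale_left_distrib algebra_simps)
  moreover have "1 + c \<noteq> 0"
    using assms(5) by (metis add_eq_0_iff)
  ultimately show ?thesis
    by (rule subspace_scale_cancel[OF subspace_S])
qed

text \<open>Words of length 1: double commutators give cyclic relations with coefficient 1.\<close>

lemma S_subset_R: "S \<subseteq> R"
proof
  fix a assume a: "a \<in> S"
  have rel: "skew x y z + skew y z x - scale 1 (skew z x y) \<in> S"
    if "x \<in> S" "y \<in> S" "z \<in> S" for x y z
    using commutator_in_S[OF commutator_in_S[OF that(1,2)] that(3)]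
      commutator_commutator[of x y z] that by simp
  have "skew a s t \<in> S" if "s \<in> S" "t \<in> S" for s t
    by (rule cyclic_cancel[of _ "skew s t a" 1 "skew t a s"])
      (use rel[of a s t] rel[of s t a] rel[of t a s] a that in simp_all)
  then show "a \<in> R" using a by (simp add: R_def)
qed

lemma lbracket_in_A: "set as \<subseteq> S \<Longrightarrow> as \<noteq> [] \<Longrightarrow> lbracket mul as \<in> A"
  by (rule lbracket_closed) auto

lemma lbracket_append: "as \<noteq> [] \<Longrightarrow> lbracket mul (as @ bs) = foldl mul (lbracket mul as) bs"
  by (cases as) (simp_all add: lbracket_def)

lemma lbracket_Cons: "lbracket mul (a # bs) = foldl mul a bs"
  by (simp add: lbracket_def)

section \<open>Words of length \<open>n\<close>, with the claim known for shorter ones\<close>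

context
  fixes n :: nat
  assumes shorter: "\<And>as. set as \<subseteq> S \<Longrightarrow> as \<noteq> [] \<Longrightarrow> length as < n \<Longrightarrow> lbracket mul as \<in> R"
begin

text \<open>The commutator lies in \<open>S\<close> and counts as one letter, which leaves a word of
  length \<open>n - 1\<close>.\<close>

lemma swap_head_in_R:
  assumes "a \<in> S" "b \<in> S" "set ys \<subseteq> S" "length ys + 2 = n"
  shows "foldl mul (mul a b - mul b a) ys \<in> R"
  using shorter[of "(mul a b - mul b a) # ys"] assms commutator_in_S[of a b]
  by (simp add: lbracket_Cons)

text \<open>As \<open>xs\<close> is short, the skew element lies in \<open>S\<close> and serves as
  the first letter of a word shorter than \<open>n\<close>.\<close>

lemma swap_in_R:
  assumes "set xs \<subseteq> S" "xs \<noteq> []" "a \<in> S" "b \<in> S" "set ys \<subseteq> S"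
    and "length xs + length ys + 2 = n"
  shows "foldl mul (skew (lbracket mul xs) a b) ys \<in> R"
proof -
  have "lbracket mul xs \<in> R"
    using assms by (intro shorter) auto
  then have "skew (lbracket mul xs) a b \<in> S"
    using assms by (intro skew_in_S)
  then show ?thesis
    using shorter[of "skew (lbracket mul xs) a b # ys"] assms
    by (cases xs) (simp_all add: lbracket_Cons)
qed

text \<open>The symmetric product is the sum of the \<open>length v + 1\<close> insertions of
  \<open>t\<close> into \<open>v\<close>, and neighbour interchanges move each \<open>t\<close> to
  the end modulo \<open>R\<close>. The suffix \<open>ys\<close> takes up the letters that the
  induction strips from \<open>v\<close>.\<close>

lemma symm_lbracket_in_R:
  assumes "v \<noteq> []" "set v \<subseteq> S" "t \<in> S" "set ys \<subseteq> S" "length v + length ys + 1 = n"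
  shows "foldl mul (symm t (lbracket mul v) -
    scale (of_nat (length v + 1)) (mul (lbracket mul v) t)) ys \<in> R"
  using assms
proof (induction v arbitrary: ys rule: rev_nonempty_induct)
  case (single x)
  have "symm t x - scale 2 (mul x t) = mul t x - mul x t"
    using scale_left_distrib[of 1 1 "mul x t"] by (simp add: symm_def)
  then show ?case
    using single swap_head_in_R[of t x ys] by simp
next
  case (snoc x v)
  let ?P = "lbracket mul v" and ?c = "of_nat (length v + 1) :: 'k"
  have mem: "?P \<in> A" "x \<in> A" "t \<in> A" "set ys \<subseteq> A" "x \<in> S" "set v \<subseteq> S"
    using snoc lbracket_in_A[of v] by auto
  let ?D = "symm t ?P - scale ?c (mul ?P t)"
  have D: "?D \<in> A"
    using mem by (intro subspace_diff[OF carrier] subspace_scale[OF carrier] symm_closed mul_closed)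
  \<comment> \<open>The first term brings every \<open>t\<close> inserted into \<open>?P\<close> to
    the place just before \<open>x\<close>; the second carries these \<open>?c\<close> copies past
    \<open>x\<close>.\<close>
  have "symm t (mul ?P x) - scale (?c + 1) (mul (mul ?P x) t)
      = mul ?D x - scale ?c (skew ?P x t)"
    using mem
    by (simp add: symm_mul skew_def mul_diff_left mul_closed symm_closed mul_scale_left
        subspace_scale[OF carrier] scale_right_diff_distrib scale_left_distrib
        del: of_nat_add of_nat_Suc)
  then have "foldl mul (symm t (mul ?P x) - scale (?c + 1) (mul (mul ?P x) t)) ys
      = foldl mul (mul ?D x) ys - scale ?c (foldl mul (skew ?P x t) ys)"
    using mem D
    by (simp add: foldl_mul_diff foldl_mul_scale mul_closed skew_closed subspace_scale[OF carrier])
  also have "\<dots> \<in> R"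
  proof (intro subspace_diff[OF subspace_R] subspace_scale[OF subspace_R])
    show "foldl mul (mul ?D x) ys \<in> R"
      using snoc.IH[of "x # ys"] snoc.prems mem by simp
    show "foldl mul (skew ?P x t) ys \<in> R"
      using snoc mem by (intro swap_in_R) auto
  qed
  finally show ?case
    using snoc.hyps by (simp add: lbracket_snoc algebra_simps)
qed

text \<open>The cyclic relations have coefficient \<open>n\<close> because a letter can be inserted
  into \<open>v\<close> at \<open>n\<close> places.\<close>

lemma skew_lbracket_snoc_in_S:
  assumes v: "v \<noteq> []" "set v \<subseteq> S" "length v + 1 = n" and S: "a \<in> S" "b \<in> S" "t \<in> S"
  shows "skew (mul (lbracket mul v) a) b t \<in> S"
proof -
  let ?P = "lbracket mul v"
  have P: "?P \<in> A" "?P \<in> R"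
    using v lbracket_in_A shorter by auto
  have sub: "symm z ?P - scale (of_nat n) (mul ?P z) \<in> R" if "z \<in> S" for z
    using symm_lbracket_in_R[of v z "[]"] v that by (simp del: of_nat_add of_nat_Suc)
  have sub': "skew (symm z ?P) x y - scale (of_nat n) (skew (mul ?P z) x y) \<in> S"
    if "x \<in> S" "y \<in> S" "z \<in> S" for x y z
    using sub that P by (intro skew_cong) (auto simp: symm_closed mul_closed)
  have rel: "skew (mul ?P x) y z + skew (mul ?P y) z x - scale (of_nat n) (skew (mul ?P z) x y) \<in> S"
    if "x \<in> S" "y \<in> S" "z \<in> S" for x y z
  proof -
    have "mul (skew ?P x y) z - mul z (skew ?P x y) \<in> S"
      using P that by (intro commutator_in_S skew_in_S)
    from subspace_add[OF subspace_S this sub'[OF that]] show ?thesis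
      using P that by (simp add: commutator_skew)
  qed
  show ?thesis
  proof (cases "n = 2")
    case False
    have "of_nat n \<noteq> (2 :: 'k)"
      using False by (metis of_nat_eq_iff of_nat_numeral)
    moreover have "of_nat n \<noteq> (-1 :: 'k)"
      using of_nat_neq_0[of n, where ?'a = 'k] by (auto simp: add.commute)
    ultimately show ?thesis
      by (rule cyclic_cancel[OF rel[OF S] rel[OF S(2,3,1)] rel[OF S(3,1,2)]])
  next
    case True
    let ?A = "skew (mul ?P a) b t" and ?B = "skew (mul ?P b) t a" and ?C = "skew (mul ?P t) a b"
    have 1: "?A + ?B - scale 2 ?C \<in> S" "?B + ?C - scale 2 ?A \<in> S"
      using rel[of a b t] rel[of b t a] S True by auto
    \<comment> \<open>With coefficient 2 the three cyclic relations add up to 0, so another element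
      of \<open>S\<close> is brought in.\<close>
    have 3: "skew ?P a (mul b t - mul t b) \<in> S"
      using P S by (intro skew_in_S commutator_in_S)
    have 4: "skew (symm b ?P) a t - scale 2 (skew (mul ?P b) a t) \<in> S"
        "skew (symm t ?P) a b - scale 2 (skew (mul ?P t) a b) \<in> S"
      using sub'[of a t b] sub'[of a b t] S True by auto
    have "skew ?P a (mul b t - mul t b)
        - (skew (symm b ?P) a t - scale 2 (skew (mul ?P b) a t))
        + (skew (symm t ?P) a b - scale 2 (skew (mul ?P t) a b)) \<in> S"
      by (intro subspace_add[OF subspace_S subspace_diff[OF subspace_S 3 4(1)] 4(2)])
    moreover have "skew (mul ?P b) a t = - ?B"
      by (rule skew_flip)
    ultimately have 2: "?A - scale 2 ?B - scale 2 ?C \<in> S"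
      using P S by (simp add: skew_commutator)
    \<comment> \<open>Twice a cyclic relation cancels \<open>?B\<close> and \<open>?C\<close> in the
      new one, and 3 is invertible in characteristic 0.\<close>
    have "scale 2 (?B + ?C - scale 2 ?A) + (?A - scale 2 ?B - scale 2 ?C) = scale (-3) ?A"
      using scale_left_distrib[of "-4" 1 ?A]
      by (simp add: scale_right_diff_distrib scale_right_distrib)
    then have "scale (-3) ?A \<in> S"
      using subspace_add[OF subspace_S subspace_scale[OF subspace_S 1(2), of 2] 2] by simp
    then show ?thesis
      by (rule subspace_scale_cancel[OF subspace_S]) simp
  qed
qed

end

theorem lbracket_in_R: "set as \<subseteq> S \<Longrightarrow> as \<noteq> [] \<Longrightarrow> lbracket mul as \<in> R"
proof (induction "length as" arbitrary: as rule: less_induct)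
  case less
  show ?case
  proof (cases "length as = 1")
    case True
    then show ?thesis
      using less.prems S_subset_R by (auto simp: length_Suc_conv)
  next
    case False
    then obtain v a where as: "as = v @ [a]" "v \<noteq> []"
      using less.prems by (cases as rule: rev_cases) auto
    have "skew (lbracket mul as) b t \<in> S" if "b \<in> S" "t \<in> S" for b t
      unfolding as(1) lbracket_snoc[OF as(2)]
      using less as that
      by (intro skew_lbracket_snoc_in_S[where n = "length as"]) auto
    then show ?thesis
      using less.prems lbracket_in_A by (simp add: R_def)
  qed
qed

end

section \<open>The map \<open>p\<close> on commutators in the free algebra\<close>

text \<open>The part of \<open>u \<circ> v\<close> made of the shuffles whose last two letters both come from \<open>v\<close>.\<close>

definition word_tail :: "'x list \<Rightarrow> 'x list \<Rightarrow> ('x list \<Rightarrow>\<^sub>0 'k::field)" where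
  "word_tail u v = (if length v < 2 then 0 else
    (\<Sum>w\<in>#shuffle u (butlast (butlast v)).
      Poly_Mapping.single (w @ [last (butlast v), last v]) 1))"

definition ztail :: "('x list \<Rightarrow>\<^sub>0 'k::field) \<Rightarrow> ('x list \<Rightarrow>\<^sub>0 'k) \<Rightarrow> ('x list \<Rightarrow>\<^sub>0 'k)" where
  "ztail f g = lin_ext zscale (\<lambda>u. lin_ext zscale (word_tail u) g) f"

lemma ztail_add_left: "ztail (f + f') g = ztail f g + ztail f' g"
  and ztail_add_right: "ztail f (g + g') = ztail f g + ztail f g'"
  and ztail_scale_left: "ztail (zscale c f) g = zscale c (ztail f g)"
  and ztail_scale_right: "ztail f (zscale c g) = zscale c (ztail f g)"
  by (simp_all add: ztail_def zs.lin_ext_add zs.lin_ext_zscale zs.lin_ext_fun_add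
      zs.lin_ext_fun_scale)

lemma ztail_zero [simp]: "ztail 0 g = 0" "ztail f 0 = 0"
  by (simp_all add: ztail_def lin_ext_def)

lemma ztail_single [simp]:
  "ztail (Poly_Mapping.single u 1) (Poly_Mapping.single v 1) = word_tail u v"
  by (simp add: ztail_def)

lemma zin_p_add: "zin_p (f + g) = zin_p f + zin_p g"
  and zin_p_scale: "zin_p (zscale c f) = zscale c (zin_p f)"
  and zin_p_zero [simp]: "zin_p 0 = 0"
  and zin_p_single [simp]: "zin_p (Poly_Mapping.single w 1) = word_p w"
  and zin_p_sum_mset: "zin_p (\<Sum>i\<in>#M. F i) = (\<Sum>i\<in>#M. zin_p (F i))"
  by (simp_all add: zin_p_def zs.lin_ext_add zs.lin_ext_zscale zs.lin_ext_sum_mset)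

lemma zin_p_uminus: "zin_p (- f) = - zin_p f"
  using zin_p_add[of f "- f"] by (simp add: eq_neg_iff_add_eq_0 add.commute)

lemma zin_p_diff: "zin_p (f - g) = zin_p f - zin_p g"
  using zin_p_add[of f "- g"] by (simp add: zin_p_uminus)

lemma word_p_simps [simp]:
  "word_p [x] = - Poly_Mapping.single [x] 1"
  "word_p (w @ [x, y]) = Poly_Mapping.single (w @ [y, x]) 1"
  by (simp_all add: word_p_def)

text \<open>The letter before the final \<open>y\<close> is either \<open>x\<close> or the last
  letter of \<open>v\<close>; the explicit sum collects the first kind.\<close>

lemma word_mul_eq_tail:
  "word_mul (u @ [x]) (v @ [y]) =
    (\<Sum>w\<in>#shuffle u v. Poly_Mapping.single (w @ [x, y]) 1) + word_tail (u @ [x]) (v @ [y])"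
proof (cases v rule: rev_cases)
  case Nil
  then show ?thesis
    using word_mul_snoc[of "u @ [x]" "[]" y] by (simp add: word_tail_def)
next
  case (snoc v' b)
  then show ?thesis
    unfolding word_mul_snoc
    by (simp add: word_tail_def shuffle_snoc image_mset.compositionality o_def butlast_append)
qed

text \<open>The last two letters of \<open>v\<close> stay together at the end, so \<open>p\<close>
  acts as it does on \<open>v\<close>. If \<open>v\<close> is a single letter, both sides are 0
  because \<open>p\<close> negates letters.\<close>

lemma zin_p_word_tail:
  assumes "v \<noteq> []"
  shows "word_tail u v + zin_p (word_tail u v) = ztail (Poly_Mapping.single u 1)
    (Poly_Mapping.single v 1 + word_p v)"
proof -
  obtain v' y where v: "v = v' @ [y]" using assms by (metis rev_exhaust)
  show ?thesis
  proof (cases v' rule: rev_cases)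
    case Nil
    then show ?thesis by (simp add: v word_tail_def)
  next
    case (snoc v'' b)
    then show ?thesis
      by (simp add: v ztail_add_right)
        (simp add: word_tail_def butlast_append zin_p_sum_mset)
  qed
qed

text \<open>The right side vanishes once \<open>p\<close> negates both factors, which yields closure
  under commutators.\<close>

lemma comm_plus_zin_p_comm:
  assumes "f \<in> Zin X" "g \<in> Zin X"
  shows "comm f g + zin_p (comm f g) = ztail f (g + zin_p g) - ztail g (f + zin_p f)"
proof -
  \<comment> \<open>Naming both sides as bilinear maps reduces the claim to words.\<close>
  define L where "L f g = comm f g + zin_p (comm f g)" for f g :: "'a list \<Rightarrow>\<^sub>0 'b"
  define T where "T f g = ztail f (g + zin_p g) - ztail g (f + zin_p f)"
    for f g :: "'a list \<Rightarrow>\<^sub>0 'b"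
  note defs = L_def T_def comm_def
  have zero: "L 0 g = 0" "L f 0 = 0" "T 0 g = 0" "T f 0 = 0" for f g
    by (simp_all add: defs)
  have add: "L (f + f') g = L f g + L f' g" "L f (g + g') = L f g + L f g'"
      "T (f + f') g = T f g + T f' g" "T f (g + g') = T f g + T f g'" for f f' g g'
    by (simp_all add: defs zmul_add_left zmul_add_right ztail_add_left ztail_add_right
        zin_p_diff zin_p_add)
  have scale: "L (zscale c f) g = zscale c (L f g)" "L f (zscale c g) = zscale c (L f g)"
      "T (zscale c f) g = zscale c (T f g)" "T f (zscale c g) = zscale c (T f g)" for c f g
    by (simp_all add: defs zmul_scale_left zmul_scale_right ztail_scale_left ztail_scale_right
        ztail_add_right zin_p_diff zin_p_scale zs.scale_right_distrib zs.scale_right_diff_distrib)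
  have "L f g = T f g" using assms(1)
  proof (induction rule: Zin_induct)
    case (word u)
    show ?case using assms(2)
    proof (induction rule: Zin_induct)
      case (word v)
      obtain u' x v' y where uv: "u = u' @ [x]" "v = v' @ [y]"
        using \<open>u \<noteq> []\<close> \<open>v \<noteq> []\<close> by (metis rev_exhaust)
      \<comment> \<open>The words ending in \<open>x y\<close> and in \<open>y x\<close> have
        opposite signs and are interchanged by \<open>p\<close>; they cancel and only the tails
        remain.\<close>
      have "L (Poly_Mapping.single u 1) (Poly_Mapping.single v 1)
        = (word_tail u v + zin_p (word_tail u v)) - (word_tail v u + zin_p (word_tail v u))"
        unfolding uv L_def comm_def zmul_single word_mul_eq_tail
        by (simp add: zin_p_diff zin_p_add zin_p_sum_mset shuffle_commute[of v' u'])
      then show ?case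
        using word \<open>u \<noteq> []\<close> by (simp add: T_def zin_p_word_tail)
    qed (simp_all add: zero add scale)
  qed (simp_all add: zero add scale)
  then show ?thesis by (simp add: L_def T_def)
qed

section \<open>Lie elements of the free algebra\<close>

lemma letter_in_Zin: "x \<in> X \<Longrightarrow> letter x \<in> Zin X"
  by (simp add: letter_def Zin_def)

lemma comm_subalgebra_skew:
  "comm_subalgebra {f \<in> Zin X. zin_p f = - f}"
proof -
  have "zs.subspace {f \<in> Zin X. zin_p f = - f}"
    using zs.subspace_0[OF subspace_Zin] zs.subspace_add[OF subspace_Zin]
      zs.subspace_scale[OF subspace_Zin]
    by (auto simp: zs.subspace_def zin_p_add zin_p_scale)
  moreover have "zin_p (comm f g) = - comm f g"
    if "f \<in> Zin X" "g \<in> Zin X" "zin_p f = - f" "zin_p g = - g" for f g :: "'a list \<Rightarrow>\<^sub>0 'b"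
    using comm_plus_zin_p_comm[OF that(1,2)] that(3,4) by (simp add: eq_neg_iff_add_eq_0 add.commute)
  ultimately show ?thesis
    by (auto simp: comm_subalgebra_def comm_def
        intro!: zs.subspace_diff[OF subspace_Zin] zmul_in_Zin)
qed

lemma ST_subset_skew: "ST X \<subseteq> {f \<in> Zin X. zin_p f = - f}"
  unfolding ST_def
  by (rule hull_minimal) (auto simp: comm_subalgebra_skew letter_in_Zin zin_p_props(2))

lemma comm_subalgebra_ST: "comm_subalgebra (ST X)"
  unfolding ST_def by (rule hull_in) (auto simp: comm_subalgebra_def intro: zs.subspace_Inter)

lemma letter_in_ST: "x \<in> X \<Longrightarrow> letter x \<in> ST X"
  unfolding ST_def by (rule hull_inc) simp

lemma commutator_closed_ST:
  "commutator_closed (zscale :: 'k::field_char_0 \<Rightarrow> _) (Zin X) zmul (ST X)"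
proof -
  interpret zinbiel_algebra "zscale :: 'k \<Rightarrow> _" "Zin X" zmul
    by (rule zinbiel_algebra_Zin)
  show ?thesis
    by unfold_locales
      (use comm_subalgebra_ST[of X, where ?'b = 'k] ST_subset_skew[of X, where ?'b = 'k] in
        \<open>auto simp: comm_subalgebra_def comm_def\<close>)
qed

text \<open>Depending on the length of \<open>w\<close> this is twice a letter, a commutator of two
  letters, or a skew element covered by \<open>lbracket_in_R\<close>.\<close>

lemma word_skew_in_ST:
  assumes "w \<in> lists X" "w \<noteq> []"
  shows "Poly_Mapping.single w 1 - word_p w \<in> (ST X :: ('x list \<Rightarrow>\<^sub>0 'k::field_char_0) set)"
proof -
  interpret commutator_closed "zscale :: 'k \<Rightarrow> _" "Zin X" zmul "ST X"
    by (rule commutator_closed_ST)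
  obtain v t where w: "w = v @ [t]" using assms(2) by (metis rev_exhaust)
  show ?thesis
  proof (cases v rule: rev_cases)
    case Nil
    then have "Poly_Mapping.single w 1 - word_p w = letter t + (letter t :: 'x list \<Rightarrow>\<^sub>0 'k)"
      by (simp add: w letter_def)
    then show ?thesis
      using assms w zs.subspace_add[OF subspace_S] by (simp add: letter_in_ST)
  next
    case (snoc u s)
    have st: "s \<in> X" "t \<in> X" "set u \<subseteq> X" using assms w snoc by auto
    have split: "Poly_Mapping.single w 1 - word_p w
        = Poly_Mapping.single (u @ [s, t]) (1 :: 'k) - Poly_Mapping.single (u @ [t, s]) 1"
      by (simp add: w snoc)
    show ?thesis
    proof (cases "u = []")
      case True
      have "Poly_Mapping.single w 1 - word_p w
          = zmul (letter s) (letter t) - zmul (letter t) (letter s :: 'x list \<Rightarrow>\<^sub>0 'k)"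
        by (simp add: split True letter_def word_mul_snoc[of _ "[]", simplified])
      then show ?thesis
        using commutator_in_S st letter_in_ST by metis
    next
      case False
      let ?P = "lbracket zmul (map letter u) :: 'x list \<Rightarrow>\<^sub>0 'k"
      have "zmul (zmul ?P (letter x)) (letter y) = Poly_Mapping.single (u @ [x, y]) 1" for x y
      proof -
        have "zmul (zmul ?P (letter x)) (letter y) = lbracket zmul (map letter (u @ [x, y]))"
          using False by (simp add: lbracket_append)
        also have "\<dots> = Poly_Mapping.single (u @ [x, y]) 1"
          by (rule lbracket_letters) simp
        finally show ?thesis .
      qed
      then have "Poly_Mapping.single w 1 - word_p w = skew ?P (letter s) (letter t)"
        by (simp add: split skew_def)
      also have "\<dots> \<in> ST X"
        using st False by (intro skew_in_S lbracket_in_R) (auto intro: letter_in_ST)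
      finally show ?thesis .
    qed
  qed
qed

text \<open>If \<open>p\<close> negates \<open>f\<close>, the difference is \<open>2 f\<close>, so
  the converse direction follows after division by 2.\<close>

lemma skew_part_in_ST:
  fixes f :: "'x list \<Rightarrow>\<^sub>0 'k::field_char_0"
  assumes "f \<in> Zin X"
  shows "f - zin_p f \<in> ST X"
proof -
  have sub: "zs.subspace (ST X :: ('x list \<Rightarrow>\<^sub>0 'k) set)"
    using comm_subalgebra_ST[of X] unfolding comm_subalgebra_def by blast
  show ?thesis using assms
  proof (induction rule: Zin_induct)
    case zero
    then show ?case using zs.subspace_0[OF sub] by simp
  next
    case (word w)
    then show ?case by (simp add: word_skew_in_ST)
  next
    case (add f g)
    then show ?case
      using zs.subspace_add[OF sub add(3,4)] by (simp add: zin_p_add algebra_simps)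
  next
    case (scale c f)
    then show ?case
      using zs.subspace_scale[OF sub scale(2), of c]
      by (simp add: zin_p_scale zs.scale_right_diff_distrib)
  qed
qed

theorem theorem2p1:
  fixes X :: "'x set" and f :: "'x list \<Rightarrow>\<^sub>0 'k::field_char_0"
  assumes "f \<in> Zin X"
  shows "f \<in> ST X \<longleftrightarrow> zin_p f = - f"
proof
  show "zin_p f = - f" if "f \<in> ST X"
    using that ST_subset_skew by blast
next
  assume "zin_p f = - f"
  then have "zscale 2 f = f - zin_p f"
    using zs.scale_left_distrib[of 1 1 f] by simp
  also have "\<dots> \<in> ST X"
    by (rule skew_part_in_ST[OF assms])
  finally show "f \<in> ST X"
    using comm_subalgebra_ST[of X] zs.subspace_scale_cancel[of "ST X" 2 f]
    unfolding comm_subalgebra_def by auto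
qed

end
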